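(* Let $n\geq 1$. There is a constant $C$ depending only on $n$, and one may take $C=(2\pi e)^{\frac{n}{2}}$, such that the following holds. Let $0<q<r\leq\infty$, let $b\in\mathbb{R}^n$, and let $f:\mathbb{R}^n\rightarrow\mathbb{R}$ be a measurable function with $0<\|f\|_q<\infty$, $\|f\|_r<\infty$ and finite multivariate $q$-moment $\Sigma_{q,b}$. Then $$\|f\|_q\leq \left(C\,(\det\Sigma_{q,b})^{\frac{1}{2}}\right)^{\frac{1}{q}-\frac{1}{r}}\|f\|_r.$$
   Context: All integrals are with respect to Lebesgue measure. For $0<p<\infty$, $\|f\|_p=\left(\int_{\mathbb{R}^n}|f(x)|^p\,d^nx\right)^{1/p}$, and $\|f\|_\infty=\operatorname{ess\,sup}_{x\in\mathbb{R}^n}|f(x)|$; when $r=\infty$, $\frac1r$ is read as $0$. For a measurable $f$ with $0<\|f\|_q<\infty$ and $b\in\mathbb{R}^n$, the multivariate $q$-moment is the $n\times n$ matrix (integrals taken entrywise) $$\Sigma_{q,b}=\frac{\int_{\mathbb{R}^n}(x-b)(x-b)^T|f(x)|^q\,d^nx}{\int_{\mathbb{R}^n}|f(x)|^q\,d^nx},$$ where $T$ denotes transpose of a (column) vector. It is finite when $\int_{\mathbb{R}^n}|x-b|^2|f(x)|^q\,d^nx<\infty$. *)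

theory Defs
  imports "HOL-Analysis.Analysis" "HOL-Probability.Essential_Supremum"
begin

text \<open>The real power, extended to \<open>\<infinity>\<close> by \<open>\<infinity>\<^sup>a = \<infinity>\<close>; intended for exponents \<open>a > 0\<close> only.\<close>

definition ennreal_rpow :: "ennreal \<Rightarrow> real \<Rightarrow> ennreal" where
  "ennreal_rpow t a = (if t = \<infinity> then \<infinity> else ennreal (enn2real t powr a))"

text \<open>\<open>\<parallel>f\<parallel>\<^sub>p\<close> for \<open>0 < p \<le> \<infinity>\<close>, valued in \<open>[0, \<infinity>]\<close> so that finiteness is a genuine condition.\<close>

definition Lp_norm :: "ereal \<Rightarrow> (real ^ 'n \<Rightarrow> real) \<Rightarrow> ennreal" where
  "Lp_norm p f =
    (if p = \<infinity> then esssup lebesgue (\<lambda>x. ennreal \<bar>f x\<bar>)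
     else ennreal_rpow (\<integral>\<^sup>+x. ennreal (\<bar>f x\<bar> powr real_of_ereal p) \<partial>lebesgue)
            (1 / real_of_ereal p))"

definition q_moment :: "real \<Rightarrow> real ^ 'n \<Rightarrow> (real ^ 'n \<Rightarrow> real) \<Rightarrow> real ^ 'n ^ 'n" where
  "q_moment q b f =
    (\<chi> i j. (LINT x|lebesgue. (x - b) $ i * (x - b) $ j * \<bar>f x\<bar> powr q)
            / (LINT x|lebesgue. \<bar>f x\<bar> powr q))"

text \<open>The Bochner integral is \<open>0\<close> on non-integrable functions, so finiteness of the moment matrix
  must be required separately.\<close>

definition finite_q_moment :: "real \<Rightarrow> real ^ 'n \<Rightarrow> (real ^ 'n \<Rightarrow> real) \<Rightarrow> bool" where
  "finite_q_moment q b f \<longleftrightarrow>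
    (\<integral>\<^sup>+x. ennreal ((norm (x - b))\<^sup>2 * \<bar>f x\<bar> powr q) \<partial>lebesgue) < \<infinity>"

end

theory Submission
  imports Defs "HOL-Probability.Distributions"
begin

text \<open>
  Let \<open>g = \<bar>f\<bar>\<^sup>q / \<integral> \<bar>f\<bar>\<^sup>q\<close>, let \<open>S\<close> be its second moment matrix about \<open>b\<close>, and let \<open>\<gamma>\<close> be the
  Gaussian density centred at \<open>b\<close> with covariance \<open>S\<close>. Then \<open>\<integral> g ln \<gamma> = - ln K\<close> with
  \<open>K = (2 \<pi> e)\<^bsup>n/2\<^esup> (det S)\<^bsup>1/2\<^esup>\<close>. Gibbs' inequality \<open>g ln g \<ge> g ln \<gamma> + g - \<gamma>\<close> together with the tangent
  line of the exponential at \<open>- ln K\<close> bounds \<open>g\<^sup>a\<close>, for \<open>a = r / q > 1\<close>, pointwise from below by an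
  expression whose integral is exactly \<open>K\<^bsup>1 - a\<^esup>\<close>; no entropy integral ever has to be finite. The
  Gaussian is built without a square root of \<open>S\<close>: Gram-Schmidt for the form \<open>S\<close> gives a volume
  preserving matrix \<open>B\<close> of determinant \<open>1\<close> making \<open>B S B\<^sup>T\<close> diagonal.
\<close>

section \<open>Measure-preserving shears and Gram-Schmidt orthogonalization\<close>

text \<open>The linear change of variables formula of the library assumes a well-ordered index type, whereas
  the index type here is only finite; a shear just needs Fubini and translation invariance.\<close>

lemma nn_integral_lborel_shear:
  fixes k w :: "'a::euclidean_space" and F :: "'a \<Rightarrow> ennreal"
  assumes F [measurable]: "F \<in> borel_measurable borel" and k: "k \<in> Basis" and w: "w \<bullet> k = 0"
  shows "(\<integral>\<^sup>+x. F (x + (w \<bullet> x) *\<^sub>R k) \<partial>lborel) = (\<integral>\<^sup>+x. F x \<partial>lborel)"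
proof -
  interpret product_sigma_finite "\<lambda>_::'a. lborel :: real measure" ..
  let ?I = "Basis - {k}"
  let ?S = "\<lambda>h. \<Sum>b\<in>?I. h b *\<^sub>R b"
  have B: "(Basis :: 'a set) = insert k ?I" using k by auto
  have split: "(\<integral>\<^sup>+x. G x \<partial>lborel) = (\<integral>\<^sup>+h. (\<integral>\<^sup>+y. G (y *\<^sub>R k + ?S h) \<partial>lborel) \<partial>(\<Pi>\<^sub>M b\<in>?I. lborel))"
    if [measurable]: "G \<in> borel_measurable borel" for G :: "'a \<Rightarrow> ennreal"
  proof -
    have "(\<integral>\<^sup>+x. G x \<partial>lborel) = (\<integral>\<^sup>+h. G (\<Sum>b\<in>Basis. h b *\<^sub>R b) \<partial>(\<Pi>\<^sub>M b\<in>Basis. lborel))"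
      by (subst lborel_eq) (simp add: nn_integral_distr)
    also have "\<dots> = (\<integral>\<^sup>+h. G (\<Sum>b\<in>insert k ?I. h b *\<^sub>R b) \<partial>(\<Pi>\<^sub>M b\<in>insert k ?I. lborel))"
      using B by simp
    also have "\<dots> = (\<integral>\<^sup>+h. (\<integral>\<^sup>+y. G (\<Sum>b\<in>insert k ?I. (h(k := y)) b *\<^sub>R b) \<partial>lborel) \<partial>(\<Pi>\<^sub>M b\<in>?I. lborel))"
      by (rule product_nn_integral_insert) auto
    also have "\<dots> = (\<integral>\<^sup>+h. (\<integral>\<^sup>+y. G (y *\<^sub>R k + ?S h) \<partial>lborel) \<partial>(\<Pi>\<^sub>M b\<in>?I. lborel))"
    proof (intro nn_integral_cong arg_cong[where f = G])
      fix h y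
      have "(\<Sum>b\<in>?I. (h(k := y)) b *\<^sub>R b) = ?S h" by (rule sum.cong) auto
      then show "(\<Sum>b\<in>insert k ?I. (h(k := y)) b *\<^sub>R b) = y *\<^sub>R k + ?S h"
        by (subst sum.insert) auto
    qed
    finally show ?thesis .
  qed
  \<comment> \<open>Since \<open>w\<close> has no \<open>k\<close> component, on each line in
    direction \<open>k\<close> the map is the translation by \<open>w \<bullet> ?S h\<close>.
    Writing \<open>1 * y\<close> gives the inner integral the shape of
    \<open>nn_integral_real_affine\<close> with slope 1.\<close>
  have "(\<integral>\<^sup>+x. F (x + (w \<bullet> x) *\<^sub>R k) \<partial>lborel)
      = (\<integral>\<^sup>+h. (\<integral>\<^sup>+y. F ((w \<bullet> ?S h + 1 * y) *\<^sub>R k + ?S h) \<partial>lborel) \<partial>(\<Pi>\<^sub>M b\<in>?I. lborel))"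
    by (subst split) (auto simp: inner_add_right w algebra_simps intro!: nn_integral_cong arg_cong[where f = F])
  also have "\<dots> = (\<integral>\<^sup>+h. (\<integral>\<^sup>+y. F (y *\<^sub>R k + ?S h) \<partial>lborel) \<partial>(\<Pi>\<^sub>M b\<in>?I. lborel))"
  proof (rule nn_integral_cong)
    fix h
    show "(\<integral>\<^sup>+y. F ((w \<bullet> ?S h + 1 * y) *\<^sub>R k + ?S h) \<partial>lborel) = (\<integral>\<^sup>+y. F (y *\<^sub>R k + ?S h) \<partial>lborel)"
      using nn_integral_real_affine[of "\<lambda>y. F (y *\<^sub>R k + ?S h)" 1 "w \<bullet> ?S h"] by simp
  qed
  also have "\<dots> = (\<integral>\<^sup>+x. F x \<partial>lborel)" by (subst split) auto
  finally show ?thesis .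
qed

text \<open>Gram-Schmidt for the form \<open>M\<close>, one row at a time. Each step composes the
  current map with a shear, so the invariance of integrals is carried through the induction beside
  \<open>det B = 1\<close>.\<close>

lemma exists_diagonalizing_shears:
  fixes M :: "real^'n^'n" and I :: "'n set"
  assumes sym: "\<And>u v. u \<bullet> (M *v v) = v \<bullet> (M *v u)"
    and pos: "\<And>v. v \<noteq> 0 \<Longrightarrow> 0 < v \<bullet> (M *v v)"
  shows "\<exists>B::real^'n^'n. det B = 1
    \<and> (\<forall>F::real^'n \<Rightarrow> ennreal. F \<in> borel_measurable borel
          \<longrightarrow> (\<integral>\<^sup>+x. F (B *v x) \<partial>lborel) = (\<integral>\<^sup>+x. F x \<partial>lborel))
    \<and> (\<forall>i\<in>I. \<forall>j\<in>I. i \<noteq> j \<longrightarrow> row i B \<bullet> (M *v row j B) = 0)"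
  using finite[of I]
proof (induction I rule: finite_induct)
  case empty
  show ?case by (rule exI[of _ "mat 1"]) simp
next
  case (insert k I)
  from insert.IH obtain B :: "real^'n^'n" where B: "det B = 1
    \<and> (\<forall>F::real^'n \<Rightarrow> ennreal. F \<in> borel_measurable borel
          \<longrightarrow> (\<integral>\<^sup>+x. F (B *v x) \<partial>lborel) = (\<integral>\<^sup>+x. F x \<partial>lborel))
    \<and> (\<forall>i\<in>I. \<forall>j\<in>I. i \<noteq> j \<longrightarrow> row i B \<bullet> (M *v row j B) = 0)" (is "_ \<and> ?meas \<and> ?orth") ..
  have detB: "det B = 1" and meas: ?meas and orth: ?orth
    using B by simp_all
  have nz: "row i B \<noteq> 0" for i
    using det_zero_row(2)[of i B] detB by auto
  \<comment> \<open>Gram-Schmidt coefficients against the rows already treated. As \<open>k\<close>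
    is not in \<open>I\<close>, \<open>c k = 0\<close>, which is the orthogonality that the shear
    lemma asks for.\<close>
  define c where "c i = (if i \<in> I then - (row k B \<bullet> (M *v row i B)) / (row i B \<bullet> (M *v row i B)) else 0)" for i
  define x where "x = (\<Sum>i\<in>I. c i *\<^sub>R row i B)"
  define B' where "B' = (\<chi> l. if l = k then row k B + x else row l B)"
  have rowB: "row i B = B $ i" for i
    by (simp add: row_def vec_eq_iff)
  have rows: "row l B' = (if l = k then row k B + x else row l B)" for l
    by (simp add: B'_def row_def vec_eq_iff)
  have "x \<in> vec.span {row j B |j. j \<noteq> k}"
    unfolding x_def scalar_mult_eq_scaleR[symmetric] using insert.hyps(2)
    by (intro vec.span_sum vec.span_scale vec.span_base) auto
  then have "det B' = 1"
    unfolding B'_def by (simp only: det_row_span detB)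
  moreover have "(\<integral>\<^sup>+y. F (B' *v y) \<partial>lborel) = (\<integral>\<^sup>+y. F y \<partial>lborel)"
    if F [measurable]: "F \<in> borel_measurable borel" for F :: "real^'n \<Rightarrow> ennreal"
  proof -
    let ?w = "\<chi> i. c i"
    \<comment> \<open>Changing row \<open>k\<close> of \<open>B\<close> in this way means applying,
      after \<open>B\<close>, the shear that adds a combination of the other coordinates to
      coordinate \<open>k\<close>.\<close>
    have "B' *v y = B *v y + (?w \<bullet> (B *v y)) *\<^sub>R axis k 1" for y
    proof -
      have "?w \<bullet> (B *v y) = (\<Sum>i\<in>UNIV. c i * (row i B \<bullet> y))"
        by (simp add: inner_vec_def[of ?w] matrix_vector_mul_component rowB)
      also have "\<dots> = (\<Sum>i\<in>I. c i * (row i B \<bullet> y))"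
        by (rule sum.mono_neutral_right) (auto simp: c_def)
      also have "\<dots> = x \<bullet> y"
        by (simp add: x_def inner_sum_left)
      finally have "?w \<bullet> (B *v y) = x \<bullet> y" .
      then show ?thesis
        by (simp add: vec_eq_iff matrix_vector_mul_component B'_def rowB axis_def inner_add_left)
    qed
    then have "(\<integral>\<^sup>+y. F (B' *v y) \<partial>lborel) = (\<integral>\<^sup>+y. F (B *v y + (?w \<bullet> (B *v y)) *\<^sub>R axis k 1) \<partial>lborel)"
      by simp
    also have "\<dots> = (\<integral>\<^sup>+y. F (y + (?w \<bullet> y) *\<^sub>R axis k 1) \<partial>lborel)"
      by (rule meas[rule_format, of "\<lambda>y. F (y + (?w \<bullet> y) *\<^sub>R axis k 1)"]) simp
    also have "\<dots> = (\<integral>\<^sup>+y. F y \<partial>lborel)"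
      by (rule nn_integral_lborel_shear) (use insert.hyps(2) in \<open>auto simp: inner_axis c_def\<close>)
    finally show ?thesis .
  qed
  moreover have k0: "(row k B + x) \<bullet> (M *v row j B) = 0" if "j \<in> I" for j
  proof -
    have "x \<bullet> (M *v row j B) = (\<Sum>i\<in>I. if i = j then c j * (row j B \<bullet> (M *v row j B)) else 0)"
      unfolding x_def inner_sum_left using orth that by (intro sum.cong) simp_all
    also have "\<dots> = c j * (row j B \<bullet> (M *v row j B))" using that by simp
    finally show ?thesis
      using pos[OF nz[of j]] that by (simp add: c_def inner_add_left)
  qed
  \<comment> \<open>\<open>k0\<close> covers the pairs with \<open>k\<close> in first place;
    symmetry of the form gives those with \<open>k\<close> in second place.\<close>
  then have "\<forall>i\<in>insert k I. \<forall>j\<in>insert k I. i \<noteq> j \<longrightarrow> row i B' \<bullet> (M *v row j B') = 0"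
    using sym k0 orth insert.hyps(2) by (simp add: rows ball_simps)
  ultimately show ?case by (intro exI[of _ B']) simp
qed

section \<open>Coordinate products, hyperplanes and diagonal congruence\<close>

lemma nn_integral_lborel_prod_vec:
  fixes \<phi> :: "'n::finite \<Rightarrow> real \<Rightarrow> ennreal"
  assumes "\<And>i. \<phi> i \<in> borel_measurable borel"
  shows "(\<integral>\<^sup>+x. (\<Prod>i\<in>UNIV. \<phi> i (x $ i)) \<partial>(lborel :: (real^'n) measure)) = (\<Prod>i\<in>UNIV. \<integral>\<^sup>+t. \<phi> i t \<partial>lborel)"
proof -
  have Basis: "(Basis :: (real^'n) set) = range (\<lambda>i. axis i 1)"
    by (auto simp: Basis_vec_def)
  have inj: "inj (\<lambda>i::'n. axis i (1::real))"
    by (auto simp: inj_on_def axis_eq_axis)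
  have "(\<integral>\<^sup>+x. (\<Prod>b\<in>Basis. \<phi> (axis_index b) (x \<bullet> b)) \<partial>(lborel :: (real^'n) measure))
      = (\<Prod>b\<in>(Basis :: (real^'n) set). \<integral>\<^sup>+t. \<phi> (axis_index b) t \<partial>lborel)"
    by (rule nn_integral_lborel_prod) (use assms in auto)
  then show ?thesis
    by (simp add: Basis prod.reindex[OF inj] axis_index_axis inner_axis)
qed

lemma ln_normal_density:
  assumes "0 < d"
  shows "ln (normal_density 0 (sqrt d) t) = - (1 / 2) * ln (2 * pi * d) - 1 / (2 * d) * t\<^sup>2"
  using assms by (simp add: normal_density_def ln_mult ln_div ln_sqrt)

lemma AE_lebesgue_inner_nonzero:
  fixes v b :: "'a::euclidean_space"
  assumes "v \<noteq> 0"
  shows "AE x in lebesgue. v \<bullet> (x - b) \<noteq> 0"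
proof -
  have "{x. v \<bullet> x = v \<bullet> b} \<in> null_sets lebesgue"
    using negligible_hyperplane[of v "v \<bullet> b"] assms by (simp add: negligible_iff_null_sets)
  from AE_not_in[OF this] show ?thesis by (simp add: inner_diff_right)
qed

text \<open>The entries of \<open>B ** (M ** transpose B)\<close> are the values of the form
  \<open>M\<close> on pairs of rows of \<open>B\<close>; this matrix is diagonal and has the
  determinant of \<open>M\<close>.\<close>

lemma diagonal_congruence_det:
  fixes B M :: "real^'n^'n"
  assumes "det B = 1" and "\<And>i j. i \<noteq> j \<Longrightarrow> row i B \<bullet> (M *v row j B) = 0"
  shows "det M = (\<Prod>i\<in>UNIV. row i B \<bullet> (M *v row i B))"
proof -
  let ?A = "B ** (M ** transpose B)"
  have A: "?A $ i $ j = row i B \<bullet> (M *v row j B)" for i j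
    by (simp add: matrix_matrix_mult_def matrix_vector_mult_def transpose_def row_def inner_vec_def)
  have "det M = det ?A" by (simp add: det_mul det_transpose assms(1))
  also have "\<dots> = (\<Prod>i\<in>UNIV. ?A $ i $ i)" by (rule det_diagonal) (simp add: A assms(2))
  finally show ?thesis by (simp add: A)
qed

section \<open>Probability densities and their second moment matrix\<close>

locale density_with_second_moment =
  fixes g :: "real^'n \<Rightarrow> real" and b :: "real^'n"
  assumes measurable_g [measurable]: "g \<in> borel_measurable lebesgue"
    and nonneg: "\<And>x. 0 \<le> g x"
    and mass: "has_bochner_integral lebesgue g 1"
    and second_moment: "integrable lebesgue (\<lambda>x. (norm (x - b))\<^sup>2 * g x)"
begin

definition S :: "real^'n^'n" where
  "S = (\<chi> i j. LINT x|lebesgue. (x - b) $ i * (x - b) $ j * g x)"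

text \<open>For positive definite \<open>S\<close> this is the exponential of the differential
  entropy of a Gaussian with covariance \<open>S\<close>.\<close>

definition K :: real where
  "K = (2 * pi * exp 1) powr (real CARD('n) / 2) * sqrt (det S)"

lemma integrable_entry: "integrable lebesgue (\<lambda>x. (x - b) $ i * (x - b) $ j * g x)"
proof (rule Bochner_Integration.integrable_bound[OF second_moment])
  have "(\<lambda>x. (x - b) $ i * (x - b) $ j) \<in> borel_measurable lebesgue"
    by (intro measurable_completion) simp
  then show "(\<lambda>x. (x - b) $ i * (x - b) $ j * g x) \<in> borel_measurable lebesgue"
    by simp
  have "norm ((x - b) $ i * (x - b) $ j * g x) \<le> norm ((norm (x - b))\<^sup>2 * g x)" for x
  proof -
    have "\<bar>(x - b) $ i\<bar> * \<bar>(x - b) $ j\<bar> \<le> norm (x - b) * norm (x - b)"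
      by (intro mult_mono component_le_norm_cart) auto
    then show ?thesis
      using nonneg[of x] by (simp add: abs_mult power2_eq_square mult_right_mono del: vector_minus_component)
  qed
  then show "AE x in lebesgue. norm ((x - b) $ i * (x - b) $ j * g x) \<le> norm ((norm (x - b))\<^sup>2 * g x)"
    by simp
qed

lemma quadratic_form:
  "has_bochner_integral lebesgue (\<lambda>x. (v \<bullet> (x - b)) * (w \<bullet> (x - b)) * g x) (v \<bullet> (S *v w))"
proof -
  have "has_bochner_integral lebesgue (\<lambda>x. \<Sum>i\<in>UNIV. \<Sum>j\<in>UNIV. v $ i * w $ j * ((x - b) $ i * (x - b) $ j * g x))
      (\<Sum>i\<in>UNIV. \<Sum>j\<in>UNIV. v $ i * w $ j * S $ i $ j)"
    unfolding S_def
    by (intro has_bochner_integral_sum has_bochner_integral_mult_right)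
      (simp add: has_bochner_integral_integrable[OF integrable_entry] del: vector_minus_component)
  also have "(\<lambda>x. \<Sum>i\<in>UNIV. \<Sum>j\<in>UNIV. v $ i * w $ j * ((x - b) $ i * (x - b) $ j * g x))
      = (\<lambda>x. (v \<bullet> (x - b)) * (w \<bullet> (x - b)) * g x)"
    unfolding inner_vec_def sum_product
    by (simp add: sum_distrib_left mult_ac del: vector_minus_component)
  also have "(\<Sum>i\<in>UNIV. \<Sum>j\<in>UNIV. v $ i * w $ j * S $ i $ j) = v \<bullet> (S *v w)"
    by (simp add: inner_vec_def matrix_vector_mult_def sum_distrib_left algebra_simps)
  finally show ?thesis .
qed

lemma S_sym: "u \<bullet> (S *v v) = v \<bullet> (S *v u)"
  using has_bochner_integral_eq[OF quadratic_form[of u v]] quadratic_form[of v u]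
  by (simp add: mult.commute)

text \<open>If the form vanished at \<open>v\<close>, then \<open>g\<close> would vanish almost
  everywhere off a hyperplane. Hyperplanes are null sets, so this contradicts total mass 1.\<close>

lemma S_pos:
  assumes "v \<noteq> 0"
  shows "0 < v \<bullet> (S *v v)"
proof -
  note Q = quadratic_form[of v v]
  have nn: "0 \<le> (v \<bullet> (x - b)) * (v \<bullet> (x - b)) * g x" for x
    using nonneg by simp
  have "v \<bullet> (S *v v) \<noteq> 0"
  proof
    assume "v \<bullet> (S *v v) = 0"
    then have "AE x in lebesgue. (v \<bullet> (x - b)) * (v \<bullet> (x - b)) * g x = 0"
      using Q nn by (subst integral_nonneg_eq_0_iff_AE[symmetric]) (auto simp: has_bochner_integral_iff)
    with AE_lebesgue_inner_nonzero[OF assms, of b] have "AE x in lebesgue. g x = 0"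
      by eventually_elim auto
    then have "integral\<^sup>L lebesgue g = 0" by (rule integral_eq_zero_AE)
    with mass show False by (simp add: has_bochner_integral_iff)
  qed
  moreover have "0 \<le> v \<bullet> (S *v v)"
    unfolding has_bochner_integral_integral_eq[OF Q, symmetric]
    by (rule Bochner_Integration.integral_nonneg) (rule nn)
  ultimately show ?thesis by simp
qed

section \<open>The Gaussian with the same second moments\<close>

text \<open>The logarithm of a Gaussian centred at \<open>b\<close> is a constant plus a quadratic
  form in \<open>x - b\<close>, so its integral against \<open>g\<close> depends only on the mass
  and on \<open>S\<close>.\<close>

lemma gaussian_reference:
  obtains \<gamma> where "\<And>x. 0 < \<gamma> x" "has_bochner_integral lebesgue \<gamma> 1"
    "has_bochner_integral lebesgue (\<lambda>x. g x * ln (\<gamma> x)) (- ln K)" "0 < K"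
proof -
  obtain B where B: "det B = 1
    \<and> (\<forall>F::real^'n \<Rightarrow> ennreal. F \<in> borel_measurable borel
          \<longrightarrow> (\<integral>\<^sup>+x. F (B *v x) \<partial>lborel) = (\<integral>\<^sup>+x. F x \<partial>lborel))
    \<and> (\<forall>i\<in>UNIV. \<forall>j\<in>UNIV. i \<noteq> j \<longrightarrow> row i B \<bullet> (S *v row j B) = 0)" (is "_ \<and> ?meas \<and> ?orth")
    using exists_diagonalizing_shears[OF S_sym S_pos] ..
  have detB: "det B = 1" and meas: ?meas and orth: ?orth
    using B by simp_all
  define d where "d i = row i B \<bullet> (S *v row i B)" for i
  have d: "0 < d i" for i
    unfolding d_def by (rule S_pos) (use det_zero_row(2)[of i B] detB in auto)
  have detS: "det S = (\<Prod>i\<in>UNIV. d i)"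
    unfolding d_def using orth by (intro diagonal_congruence_det detB) simp
  have K: "0 < K" unfolding K_def detS using d by (simp add: prod_pos)
  \<comment> \<open>Each summand is the entropy of a one-dimensional normal law with variance
    \<open>d i\<close>.\<close>
  have lnK: "ln K = (\<Sum>i\<in>UNIV. (1 / 2) * ln (2 * pi * d i) + 1 / 2)"
  proof -
    have "ln K = real CARD('n) / 2 * ln (2 * pi * exp 1) + (\<Sum>i\<in>UNIV. ln (d i)) / 2"
      unfolding K_def detS using d prod_pos[of UNIV d] ln_prod[of UNIV d]
      by (simp add: ln_mult ln_powr ln_sqrt less_imp_neq[symmetric])
    also have "\<dots> = (\<Sum>i\<in>UNIV. (1 / 2) * ln (2 * pi * d i) + 1 / 2)"
    proof -
      have "ln (2 * pi * d i) = ln (2 * pi) + ln (d i)" for i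
        using d[of i] by (simp add: ln_mult)
      then show ?thesis
        by (simp add: ln_mult sum.distrib sum_divide_distrib[symmetric] field_simps)
    qed
    finally show ?thesis .
  qed
  define G where "G y = (\<Prod>i\<in>UNIV. normal_density 0 (sqrt (d i)) (y $ i))" for y :: "real^'n"
  define \<gamma> where "\<gamma> x = G (B *v (x - b))" for x
  have [measurable]: "G \<in> borel_measurable borel"
    unfolding G_def by measurable
  have G_pos: "0 < G y" for y
    unfolding G_def by (intro prod_pos normal_density_pos) (simp add: d)
  have meas_B [measurable]: "(\<lambda>x. B *v x) \<in> borel_measurable borel"
    by (intro borel_measurable_continuous_onI matrix_vector_mult_linear_continuous_on)
  have \<gamma>_meas: "\<gamma> \<in> borel_measurable borel"
    unfolding \<gamma>_def by measurable
  \<comment> \<open>Total mass 1: remove the translation, then \<open>B\<close> by its invariance,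
    and split the rest into one-dimensional normal integrals.\<close>
  have "(\<integral>\<^sup>+x. \<gamma> x \<partial>lebesgue) = (\<integral>\<^sup>+x. G (B *v (x - b)) \<partial>lborel)"
    using \<gamma>_meas by (simp add: nn_integral_completion \<gamma>_def)
  also have "\<dots> = (\<integral>\<^sup>+x. G (B *v x) \<partial>lborel)"
    using nn_integral_distr[of "(+) (- b)" lborel borel "\<lambda>x. ennreal (G (B *v x))"] meas_B
    by (simp add: lborel_distr_plus)
  also have "\<dots> = (\<integral>\<^sup>+x. G x \<partial>lborel)"
    by (rule meas[rule_format, of "\<lambda>x. ennreal (G x)"]) simp
  also have "\<dots> = (\<integral>\<^sup>+x. (\<Prod>i\<in>UNIV. ennreal (normal_density 0 (sqrt (d i)) (x $ i))) \<partial>lborel)"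
    unfolding G_def by (simp add: prod_ennreal)
  also have "\<dots> = (\<Prod>i\<in>UNIV. \<integral>\<^sup>+t. ennreal (normal_density 0 (sqrt (d i)) t) \<partial>lborel)"
    by (rule nn_integral_lborel_prod_vec) simp
  also have "\<dots> = 1"
    by (simp add: nn_integral_eq_integral integral_normal_density integrable_normal_density d)
  finally have "has_bochner_integral lebesgue \<gamma> 1"
    using \<gamma>_meas G_pos
    by (intro has_bochner_integral_nn_integral) (auto simp: \<gamma>_def less_imp_le intro!: measurable_completion)
  moreover have "has_bochner_integral lebesgue (\<lambda>x. g x * ln (\<gamma> x)) (- ln K)"
  proof -
    \<comment> \<open>The variance of the \<open>i\<close>-th coordinate under \<open>g\<close> is
      again \<open>d i\<close>, so every quadratic term integrates to 1/2; this is the source of the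
      factor e in \<open>K\<close>.\<close>
    have "has_bochner_integral lebesgue
        (\<lambda>x. \<Sum>i\<in>UNIV. - (1 / 2) * ln (2 * pi * d i) * g x
          - 1 / (2 * d i) * ((row i B \<bullet> (x - b)) * (row i B \<bullet> (x - b)) * g x))
        (\<Sum>i\<in>UNIV. - (1 / 2) * ln (2 * pi * d i) * 1 - 1 / (2 * d i) * d i)"
      unfolding d_def
      by (intro has_bochner_integral_sum has_bochner_integral_diff has_bochner_integral_mult_right
          quadratic_form mass) 
    also have "(\<Sum>i\<in>UNIV. - (1 / 2) * ln (2 * pi * d i) * 1 - 1 / (2 * d i) * d i) = - ln K"
      unfolding lnK sum_negf[symmetric] using d by (intro sum.cong) (auto simp: field_simps less_imp_neq[symmetric])
    also have "(\<lambda>x. \<Sum>i\<in>UNIV. - (1 / 2) * ln (2 * pi * d i) * g x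
          - 1 / (2 * d i) * ((row i B \<bullet> (x - b)) * (row i B \<bullet> (x - b)) * g x)) = (\<lambda>x. g x * ln (\<gamma> x))"
    proof
      fix x
      have nd: "normal_density 0 (sqrt (d i)) t \<noteq> 0" for i t
        using normal_density_pos[of "sqrt (d i)" 0 t] d[of i] by simp
      have "(B *v (x - b)) $ i = row i B \<bullet> (x - b)" for i
        by (simp add: matrix_vector_mul_component row_def)
      then have "ln (\<gamma> x) = (\<Sum>i\<in>UNIV. ln (normal_density 0 (sqrt (d i)) (row i B \<bullet> (x - b))))"
        unfolding \<gamma>_def G_def by (subst ln_prod) (simp_all add: nd)
      then show "(\<Sum>i\<in>UNIV. - (1 / 2) * ln (2 * pi * d i) * g x
          - 1 / (2 * d i) * ((row i B \<bullet> (x - b)) * (row i B \<bullet> (x - b)) * g x)) = g x * ln (\<gamma> x)"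
        by (simp add: ln_normal_density[OF d] sum_distrib_left algebra_simps power2_eq_square)
    qed
    finally show ?thesis .
  qed
  ultimately show ?thesis
    using that[of \<gamma>] G_pos K by (simp add: \<gamma>_def)
qed

end

section \<open>Pointwise convexity inequalities\<close>

text \<open>This is \<open>ln u \<le> u - 1\<close> at \<open>u = c / t\<close>, multiplied by
  \<open>t\<close>. At \<open>t = 0\<close> it reads \<open>- c \<le> 0\<close>.\<close>

lemma gibbs_pointwise:
  fixes t c :: real
  assumes "0 \<le> t" "0 < c"
  shows "t * ln c + t - c \<le> t * ln t"
proof (cases "t = 0")
  case False
  with assms have t: "0 < t" by simp
  have "ln (c / t) \<le> c / t - 1"
    using t assms by (intro ln_le_minus_one) simp
  then have "t * (ln c - ln t) \<le> t * (c / t - 1)"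
    using t assms by (intro mult_left_mono) (simp_all add: ln_div)
  with t show ?thesis by (simp add: algebra_simps)
qed (use assms in simp)

text \<open>The tangent line of exp bounds \<open>t powr (a - 1) * k powr (a - 1)\<close> below by
  \<open>1 + (a - 1) * (ln t + ln k)\<close>. Multiplying by \<open>t\<close> produces
  \<open>t * ln t\<close>, which Gibbs' inequality replaces by terms that stay integrable for
  \<open>t = g x\<close> and \<open>c = \<gamma> x\<close>.\<close>

lemma powr_tangent:
  fixes t c k a :: real
  assumes "0 \<le> t" "0 < c" "0 < k" "1 < a"
  shows "k powr (1 - a) * (t + (a - 1) * (t * ln c + t - c + t * ln k)) \<le> t powr a"
proof -
  have "t + (a - 1) * (t * ln c + t - c + t * ln k) \<le> t + (a - 1) * (t * ln t + t * ln k)"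
    using gibbs_pointwise[OF assms(1,2)] assms(4) by (intro add_left_mono mult_left_mono) simp_all
  also have "\<dots> \<le> t powr a * k powr (a - 1)"
  proof (cases "t = 0")
    case False
    with assms have t: "0 < t" by simp
    have "t * (1 + (a - 1) * (ln t + ln k)) \<le> t * exp ((a - 1) * (ln t + ln k))"
      using t by (intro mult_left_mono exp_ge_add_one_self) simp
    also have "exp ((a - 1) * (ln t + ln k)) = t powr (a - 1) * k powr (a - 1)"
      using t assms by (simp add: powr_def exp_add[symmetric] algebra_simps)
    also have "t * (t powr (a - 1) * k powr (a - 1)) = t powr a * k powr (a - 1)"
      using t by (simp add: powr_diff)
    finally show ?thesis by (simp add: algebra_simps)
  qed simp
  finally have "k powr (1 - a) * (t + (a - 1) * (t * ln c + t - c + t * ln k))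
      \<le> k powr (1 - a) * (t powr a * k powr (a - 1))"
    by (intro mult_left_mono) simp_all
  also have "\<dots> = t powr a"
    using assms by (simp add: powr_add[symmetric] mult.left_commute)
  finally show ?thesis .
qed

section \<open>Lower bounds for power integrals and essential bounds of a density\<close>

context density_with_second_moment
begin

lemma power_integral_lower_bound:
  assumes a: "1 < a" and int: "integrable lebesgue (\<lambda>x. g x powr a)"
  shows "K powr (1 - a) \<le> (LINT x|lebesgue. g x powr a)"
proof -
  obtain \<gamma> where \<gamma>: "\<And>x. 0 < \<gamma> x" "has_bochner_integral lebesgue \<gamma> 1"
    "has_bochner_integral lebesgue (\<lambda>x. g x * ln (\<gamma> x)) (- ln K)" and K: "0 < K"
    by (rule gaussian_reference) (rule that)
  \<comment> \<open>The choice \<open>k = K\<close> makes the logarithms cancel: the factor of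
    \<open>a - 1\<close> in the value is 0, leaving \<open>K powr (1 - a)\<close>.\<close>
  have H: "has_bochner_integral lebesgue
      (\<lambda>x. K powr (1 - a) * (g x + (a - 1) * (g x * ln (\<gamma> x) + g x - \<gamma> x + g x * ln K)))
      (K powr (1 - a) * (1 + (a - 1) * (- ln K + 1 - 1 + 1 * ln K)))"
    by (intro has_bochner_integral_mult_right has_bochner_integral_mult_left has_bochner_integral_add
        has_bochner_integral_diff \<gamma> mass)
  have "K powr (1 - a)
      = (LINT x|lebesgue. K powr (1 - a) * (g x + (a - 1) * (g x * ln (\<gamma> x) + g x - \<gamma> x + g x * ln K)))"
    using has_bochner_integral_integral_eq[OF H] by simp
  also have "\<dots> \<le> (LINT x|lebesgue. g x powr a)"
    using H int powr_tangent[OF nonneg \<gamma>(1) K a]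
    by (intro integral_mono) (auto simp: has_bochner_integral_iff)
  finally show ?thesis .
qed

text \<open>The endpoint case: \<open>g x * ln m\<close> dominates \<open>g x * ln (g x)\<close>
  almost everywhere, and Gibbs' inequality bounds the latter below. Only the two outer expressions
  are integrated.\<close>

lemma essential_bound_lower_bound:
  assumes m: "AE x in lebesgue. g x \<le> m"
  shows "1 \<le> K * m"
proof -
  obtain \<gamma> where \<gamma>: "\<And>x. 0 < \<gamma> x" "has_bochner_integral lebesgue \<gamma> 1"
    "has_bochner_integral lebesgue (\<lambda>x. g x * ln (\<gamma> x)) (- ln K)" and K: "0 < K"
    by (rule gaussian_reference) (rule that)
  have m_pos: "0 < m"
  \<comment> \<open>A bound \<open>m \<le> 0\<close> would force \<open>g\<close> to vanish almost
    everywhere, against mass 1.\<close>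
  proof (rule ccontr)
    assume neg: "\<not> 0 < m"
    have "AE x in lebesgue. g x = 0"
      using m
    proof eventually_elim
      case (elim x)
      with nonneg[of x] neg show ?case by linarith
    qed
    then have "integral\<^sup>L lebesgue g = 0" by (rule integral_eq_zero_AE)
    with mass show False by (simp add: has_bochner_integral_iff)
  qed
  have H: "has_bochner_integral lebesgue (\<lambda>x. g x * ln (\<gamma> x) + g x - \<gamma> x) (- ln K + 1 - 1)"
    by (intro has_bochner_integral_add has_bochner_integral_diff \<gamma> mass)
  have H': "has_bochner_integral lebesgue (\<lambda>x. g x * ln m) (1 * ln m)"
    by (intro has_bochner_integral_mult_left mass)
  have "AE x in lebesgue. g x * ln (\<gamma> x) + g x - \<gamma> x \<le> g x * ln m"
    using m
  proof eventually_elim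
    case (elim x)
    have "g x * ln (g x) \<le> g x * ln m"
      using elim nonneg[of x] by (cases "g x = 0") (auto intro!: mult_left_mono)
    with gibbs_pointwise[OF nonneg \<gamma>(1)] show ?case by (rule order_trans)
  qed
  then have "- ln K \<le> ln m"
    using integral_mono_AE[of lebesgue "\<lambda>x. g x * ln (\<gamma> x) + g x - \<gamma> x" "\<lambda>x. g x * ln m"] H H' mass
    by (simp add: has_bochner_integral_iff)
  then have "0 \<le> ln (K * m)" using K m_pos by (simp add: ln_mult)
  then show ?thesis using K m_pos by simp
qed

end

section \<open>From densities back to norms\<close>

theorem theorem2:
  fixes q :: real and r :: ereal and b :: "real ^ 'n" and f :: "real ^ 'n \<Rightarrow> real"
  assumes "0 < q" and "ereal q < r"
    and "f \<in> borel_measurable lebesgue"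
    and "0 < Lp_norm (ereal q) f" and "Lp_norm (ereal q) f < \<infinity>"
    and "Lp_norm r f < \<infinity>"
    and "finite_q_moment q b f"
  shows "Lp_norm (ereal q) f \<le>
    ennreal (((2 * pi * exp 1) powr (real CARD('n) / 2) * sqrt (det (q_moment q b f)))
               powr (1 / q - real_of_ereal (1 / r)))
    * Lp_norm r f"
proof -
  note q = \<open>0 < q\<close> and [measurable] = \<open>f \<in> borel_measurable lebesgue\<close>
  define N where "N p = enn2real (\<integral>\<^sup>+x. ennreal (\<bar>f x\<bar> powr p) \<partial>lebesgue)" for p
  \<comment> \<open>\<open>enn2real\<close> sends infinity to 0, so \<open>N p\<close> is the true
    integral only when that is finite; \<open>ennreal_rpow\<close> preserves infinity, so a finite
    norm ensures this.\<close>
  have finite_norm: "Lp_norm (ereal p) f = ennreal (N p powr (1 / p))"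
    "has_bochner_integral lebesgue (\<lambda>x. \<bar>f x\<bar> powr p) (N p)"
    if "Lp_norm (ereal p) f < \<infinity>" for p
  proof -
    have fin: "(\<integral>\<^sup>+x. ennreal (\<bar>f x\<bar> powr p) \<partial>lebesgue) < \<infinity>"
      using that by (auto simp: Lp_norm_def ennreal_rpow_def top.not_eq_extremum split: if_splits)
    then show "Lp_norm (ereal p) f = ennreal (N p powr (1 / p))"
      by (simp add: Lp_norm_def ennreal_rpow_def N_def)
    show "has_bochner_integral lebesgue (\<lambda>x. \<bar>f x\<bar> powr p) (N p)"
      using fin by (intro has_bochner_integral_nn_integral) (auto simp: N_def)
  qed
  note Nq = finite_norm[OF \<open>Lp_norm (ereal q) f < \<infinity>\<close>]
  define I where "I = N q"
  have I: "0 < I"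
    using \<open>0 < Lp_norm (ereal q) f\<close> unfolding Nq(1) I_def
    by (cases "N q = 0") (auto simp: N_def less_le)
  define g where "g x = \<bar>f x\<bar> powr q / I" for x
  interpret density_with_second_moment g b
  proof
    show "g \<in> borel_measurable lebesgue" unfolding g_def by measurable
    show "0 \<le> g x" for x using I by (simp add: g_def)
    show "has_bochner_integral lebesgue g 1"
      unfolding g_def using has_bochner_integral_divide_zero[OF Nq(2), of I] I by (simp add: I_def)
    have "(\<lambda>x. (norm (x - b))\<^sup>2) \<in> borel_measurable lebesgue"
      by (intro measurable_completion) simp
    then have "integrable lebesgue (\<lambda>x. (norm (x - b))\<^sup>2 * \<bar>f x\<bar> powr q)"
      using \<open>finite_q_moment q b f\<close> unfolding finite_q_moment_def
      by (intro integrableI_nonneg) auto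
    from integrable_divide_zero[OF this, of I]
    show "integrable lebesgue (\<lambda>x. (norm (x - b))\<^sup>2 * g x)"
      unfolding g_def by simp
  qed
  have "S = q_moment q b f"
    unfolding S_def q_moment_def g_def has_bochner_integral_integral_eq[OF Nq(2)]
    by (simp add: vec_eq_iff I_def)
  then have K: "(2 * pi * exp 1) powr (real CARD('n) / 2) * sqrt (det (q_moment q b f)) = K"
    by (simp add: K_def)
  have "0 < K" by (rule gaussian_reference) assumption
  show ?thesis
  proof (cases r)
    case (real s)
    then have s: "q < s" "0 < s" using assms by auto
    have Ns: "Lp_norm (ereal s) f = ennreal (N s powr (1 / s))"
      "has_bochner_integral lebesgue (\<lambda>x. \<bar>f x\<bar> powr s) (N s)"
      using finite_norm[of s] assms real by auto
    \<comment> \<open>The exponent \<open>a = s / q\<close> turns the power integral of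
      \<open>g\<close> into that of \<open>f\<close> with exponent \<open>s\<close>.\<close>
    have g_powr: "g x powr (s / q) = \<bar>f x\<bar> powr s / I powr (s / q)" for x
      using I q by (simp add: g_def powr_divide powr_powr)
    have H: "has_bochner_integral lebesgue (\<lambda>x. g x powr (s / q)) (N s / I powr (s / q))"
      unfolding g_powr using Ns(2) I by (intro has_bochner_integral_divide_zero) auto
    have "K powr (1 - s / q) \<le> N s / I powr (s / q)"
      using power_integral_lower_bound[of "s / q"] H s q by (simp add: has_bochner_integral_iff)
    then have "I powr (s / q) \<le> K powr (s / q - 1) * N s"
      using I \<open>0 < K\<close> by (simp add: field_simps powr_diff)
    \<comment> \<open>The \<open>1 / s\<close> power turns integrals into norms and yields the
      exponent \<open>1 / q - 1 / s\<close> of \<open>K\<close>.\<close>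
    then have "(I powr (s / q)) powr (1 / s) \<le> (K powr (s / q - 1) * N s) powr (1 / s)"
      using s by (intro powr_mono2) auto
    also have "\<dots> = K powr ((s / q - 1) * (1 / s)) * N s powr (1 / s)"
      by (simp add: powr_mult powr_powr N_def)
    also have "(s / q - 1) * (1 / s) = 1 / q - 1 / s"
      using s q by (simp add: field_simps)
    finally have "I powr (1 / q) \<le> K powr (1 / q - 1 / s) * N s powr (1 / s)"
      using s by (simp add: powr_powr)
    then show ?thesis
      unfolding K unfolding real Nq(1) Ns(1) I_def
      using s by (simp add: ennreal_mult[symmetric] one_ereal_def divide_ereal_def inverse_eq_divide)
  next
    case PInf
    define m where "m = enn2real (Lp_norm r f)"
    have m: "Lp_norm r f = ennreal m" "0 \<le> m"
      using \<open>Lp_norm r f < \<infinity>\<close> by (simp_all add: m_def)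
    have "AE x in lebesgue. ennreal \<bar>f x\<bar> \<le> Lp_norm r f"
      using PInf by (simp add: Lp_norm_def esssup_AE)
    then have "AE x in lebesgue. g x \<le> m powr q / I"
    proof eventually_elim
      case (elim x)
      then have "\<bar>f x\<bar> \<le> m" using m by simp
      then show ?case
        using q I by (auto simp: g_def intro!: divide_right_mono powr_mono2)
    qed
    then have "I \<le> K * m powr q"
      using essential_bound_lower_bound[of "m powr q / I"] I by (simp add: field_simps)
    then have "I powr (1 / q) \<le> (K * m powr q) powr (1 / q)"
      using q I by (intro powr_mono2) auto
    also have "\<dots> = K powr (1 / q) * m"
      using q m(2) \<open>0 < K\<close> by (simp add: powr_mult powr_powr)
    \<comment> \<open>In \<open>ereal\<close>, \<open>1 / \<infinity>\<close> is 0, so the exponent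
      of the theorem is \<open>1 / q\<close> here.\<close>
    finally show ?thesis
      unfolding K Nq(1) m(1) I_def using PInf m(2) by (simp add: ennreal_mult[symmetric])
  qed (use assms in auto)
qed

end
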